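(* Let $\mathbb{F}_q$ be the finite field with $q$ elements, let $\mathcal{H}=\mathcal{H}(m,n,\mathcal{X},f)$ be the side information hypergraph of an instance $(m,n,\mathcal{X},f)$ of the index coding with side information (ICSI) problem, and let $\delta\ge 0$ be an integer. Then there exists a $\delta$-error-correcting index code ($(\delta,\mathcal{H})$-ECIC) over $\mathbb{F}_q$ of length $N$ if $$\sum_{i\in[m]} q^{\,n-|\mathcal{X}_i|-1}\ <\ \frac{q^N}{V_q(N,2\delta)},$$ where $$V_q(N,2\delta)=\sum_{\ell=0}^{2\delta}\binom{N}{\ell}(q-1)^\ell .$$
   Context: Notation: $[n]=\{1,\dots,n\}$; $\mathsf{wt}$ denotes Hamming weight; for $\boldsymbol{x}\in\mathbb{F}_q^n$ and $B\subseteq[n]$, $\boldsymbol{x}_B$ is the subvector of $\boldsymbol{x}$ indexed by $B$. ICSI instance: integers $m,n\ge 1$, subsets $\mathcal{X}_i\subseteq[n]$ for $i\in[m]$ with $\mathcal{X}=(\mathcal{X}_1,\dots,\mathcal{X}_m)$, and a map $f:[m]\to[n]$ with $f(i)\notin\mathcal{X}_i$ for all $i$. (Receiver $R_i$ knows $\boldsymbol{x}_{\mathcal{X}_i}$ and wants $x_{f(i)}$.) The side information hypergraph $\mathcal{H}(m,n,\mathcal{X},f)$ is the directed hypergraph with vertex set $[n]$ and edges $(f(i),\mathcal{X}_i)$, $i\in[m]$; it represents the instance. ECIC: a $\delta$-error-correcting index code ($(\delta,\mathcal{H})$-ECIC) over $\mathbb{F}_q$ of length $N$ is a map $\mathfrak{E}:\mathbb{F}_q^n\to\mathbb{F}_q^N$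 such that for each $i\in[m]$ there is a map $\mathfrak{D}_i:\mathbb{F}_q^N\times\mathbb{F}_q^{|\mathcal{X}_i|}\to\mathbb{F}_q$ with $\mathfrak{D}_i(\mathfrak{E}(\boldsymbol{x})+\boldsymbol{\epsilon}_i,\boldsymbol{x}_{\mathcal{X}_i})=x_{f(i)}$ for all $\boldsymbol{x}\in\mathbb{F}_q^n$ and all $\boldsymbol{\epsilon}_i\in\mathbb{F}_q^N$ with $\mathsf{wt}(\boldsymbol{\epsilon}_i)\le\delta$. *)

theory Defs
  imports Complex_Main "HOL-Library.FuncSet" "HOL-Library.Cardinality"
begin

text \<open>
  The space \<open>F^k\<close>, with coordinates indexed by \<open>{1..k}\<close>; the extensional function space
  makes equality of vectors the same as equality of their coordinates.
\<close>

definition vecs :: "nat \<Rightarrow> (nat \<Rightarrow> 'a) set" where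
  "vecs k = {1..k} \<rightarrow>\<^sub>E UNIV"

definition vec_add :: "nat \<Rightarrow> (nat \<Rightarrow> 'a::plus) \<Rightarrow> (nat \<Rightarrow> 'a) \<Rightarrow> (nat \<Rightarrow> 'a)" where
  "vec_add k x y = (\<lambda>j\<in>{1..k}. x j + y j)"

definition hamming_weight :: "nat \<Rightarrow> (nat \<Rightarrow> 'a::zero) \<Rightarrow> nat" where
  "hamming_weight k x = card {j \<in> {1..k}. x j \<noteq> 0}"

text \<open>
  The subvector of \<open>x\<close> indexed by a finite set \<open>B\<close>, as an element of \<open>vecs (card B)\<close>: its
  \<open>j\<close>-th coordinate is \<open>x\<close> at the \<open>j\<close>-th smallest element of \<open>B\<close> (list positions start at 0).
\<close>

definition subvec :: "(nat \<Rightarrow> 'a) \<Rightarrow> nat set \<Rightarrow> (nat \<Rightarrow> 'a)" where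
  "subvec x B = (\<lambda>j\<in>{1..card B}. x (sorted_list_of_set B ! (j - 1)))"

definition icsi_instance ::
  "nat \<Rightarrow> nat \<Rightarrow> (nat \<Rightarrow> nat set) \<Rightarrow> (nat \<Rightarrow> nat) \<Rightarrow> bool" where
  "icsi_instance m n X f \<longleftrightarrow>
     1 \<le> m \<and> 1 \<le> n \<and>
     (\<forall>i\<in>{1..m}. X i \<subseteq> {1..n}) \<and> f \<in> {1..m} \<rightarrow> {1..n} \<and> (\<forall>i\<in>{1..m}. f i \<notin> X i)"

text \<open>
  A directed hypergraph on the vertices \<open>{1..order}\<close> with edges indexed by \<open>{1..size}\<close>.  The
  edges form an indexed family, since two receivers may give rise to the same pair.
\<close>

record dhypergraph =
  hg_order :: nat
  hg_size :: nat
  hg_edge :: "nat \<Rightarrow> nat \<times> nat set"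

definition side_info_hypergraph ::
  "nat \<Rightarrow> nat \<Rightarrow> (nat \<Rightarrow> nat set) \<Rightarrow> (nat \<Rightarrow> nat) \<Rightarrow> dhypergraph" where
  "side_info_hypergraph m n X f =
     \<lparr>hg_order = n, hg_size = m, hg_edge = (\<lambda>i\<in>{1..m}. (f i, X i))\<rparr>"

definition is_ecic ::
  "nat \<Rightarrow> dhypergraph \<Rightarrow> nat \<Rightarrow> ((nat \<Rightarrow> 'a::field) \<Rightarrow> (nat \<Rightarrow> 'a)) \<Rightarrow> bool" where
  "is_ecic \<delta> H N E \<longleftrightarrow>
     E \<in> vecs (hg_order H) \<rightarrow> vecs N \<and>
     (\<forall>i\<in>{1..hg_size H}. \<exists>D :: (nat \<Rightarrow> 'a) \<times> (nat \<Rightarrow> 'a) \<Rightarrow> 'a.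
        \<forall>x\<in>vecs (hg_order H). \<forall>\<epsilon>\<in>vecs N. hamming_weight N \<epsilon> \<le> \<delta> \<longrightarrow>
          D (vec_add N (E x) \<epsilon>, subvec x (snd (hg_edge H i))) = x (fst (hg_edge H i)))"

definition hamming_ball_volume :: "nat \<Rightarrow> nat \<Rightarrow> nat \<Rightarrow> nat" where
  "hamming_ball_volume q N r = (\<Sum>l=0..r. (N choose l) * (q - 1) ^ l)"

end

theory Submission
  imports Defs
begin

text \<open>
  Encode linearly, \<open>x \<mapsto> x M\<close>, with an \<open>n \<times> N\<close> matrix \<open>M\<close>. Receiver \<open>i\<close> can decode as soon as
  \<open>z M\<close> has weight more than \<open>2\<delta>\<close> for every \<open>z\<close> that vanishes on \<open>X i\<close> and is nonzero at \<open>f i\<close>;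
  by scaling, it suffices to treat the \<open>q ^ (n - card (X i) - 1)\<close> many \<open>z\<close> with \<open>z (f i) = 1\<close>.
  For a fixed such \<open>z\<close> the vector \<open>z M\<close> is uniformly distributed when \<open>M\<close> is, so the proportion of
  matrices that are bad for \<open>z\<close> is \<open>V\<^sub>q(N, 2\<delta>) / q ^ N\<close>, and the hypothesis makes the sum of
  these proportions less than 1.
\<close>

section \<open>Cardinalities of vector spaces and Hamming balls\<close>

lemma finite_vecs: "finite (vecs k :: (nat \<Rightarrow> 'a::finite) set)"
  unfolding vecs_def by (intro finite_PiE) auto

lemma card_vecs: "card (vecs k :: (nat \<Rightarrow> 'a::finite) set) = CARD('a) ^ k"
  unfolding vecs_def by (simp add: card_PiE)

text \<open>Prescribing the support constrains each coordinate separately: there are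
  \<open>CARD('a) - 1\<close> choices on \<open>S\<close> and a single one elsewhere.\<close>

lemma card_vecs_support:
  assumes "S \<subseteq> {1..N}"
  shows "card {y \<in> vecs N. {j \<in> {1..N}. y j \<noteq> (0::'a::{zero,finite})} = S} = (CARD('a) - 1) ^ card S"
proof -
  have "{y \<in> vecs N. {j \<in> {1..N}. y j \<noteq> (0::'a)} = S} = PiE {1..N} (\<lambda>j. if j \<in> S then - {0} else {0})"
    using assms by (auto simp: vecs_def PiE_iff extensional_def split: if_splits)
  moreover have "card (PiE {1..N} (\<lambda>j. if j \<in> S then - {0::'a} else {0}))
      = (\<Prod>j\<in>{1..N}. if j \<in> S then CARD('a) - 1 else 1)"
    by (simp add: card_PiE card_Diff_singleton Compl_eq_Diff_UNIV if_distrib cong: if_cong)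
  moreover have "\<dots> = (\<Prod>j\<in>{1..N} \<inter> S. CARD('a) - 1)"
    by (rule prod.inter_restrict [symmetric]) simp
  ultimately show ?thesis
    using assms by (simp add: Int_absorb1)
qed

text \<open>The ball is the disjoint union, over all supports \<open>S\<close> of size at most
  \<open>r\<close>, of the vectors with that support; the supports are grouped by their size
  \<open>l\<close>.\<close>

lemma card_hamming_ball:
  "card {y \<in> vecs N. hamming_weight N (y :: nat \<Rightarrow> 'a::{zero,finite}) \<le> r}
     = hamming_ball_volume CARD('a) N r"
proof -
  let ?supp = "\<lambda>y :: nat \<Rightarrow> 'a. {j \<in> {1..N}. y j \<noteq> 0}"
  let ?sub = "\<lambda>l. {S. S \<subseteq> {1..N} \<and> card S = l}"
  let ?A = "\<lambda>S. {y \<in> vecs N. ?supp y = S}"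
  have fin: "finite (?A S)" for S
    by (rule finite_subset [OF _ finite_vecs]) auto
  have fin_sub: "finite (?sub l)" for l
    by (rule finite_subset [of _ "Pow {1..N}"]) auto
  have "{y \<in> vecs N. hamming_weight N (y :: nat \<Rightarrow> 'a) \<le> r} = (\<Union>l\<in>{0..r}. \<Union>S\<in>?sub l. ?A S)"
    by (auto simp: hamming_weight_def)
  also have "card \<dots> = (\<Sum>l=0..r. card (\<Union>S\<in>?sub l. ?A S))"
    by (intro card_UN_disjoint) (use fin fin_sub in auto)
  also have "\<dots> = (\<Sum>l=0..r. \<Sum>S\<in>?sub l. card (?A S))"
    by (intro sum.cong card_UN_disjoint) (use fin fin_sub in auto)
  also have "\<dots> = (\<Sum>l=0..r. \<Sum>S\<in>?sub l. (CARD('a) - 1) ^ l)"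
    by (intro sum.cong refl) (use card_vecs_support in auto)
  also have "\<dots> = hamming_ball_volume CARD('a) N r"
    by (simp add: hamming_ball_volume_def n_subsets)
  finally show ?thesis .
qed

section \<open>Subvectors, distance and unique decoding\<close>

lemma hamming_weight_diff_le:
  fixes x y :: "nat \<Rightarrow> 'a::ab_group_add"
  shows "hamming_weight N (\<lambda>j. x j - y j) \<le> hamming_weight N x + hamming_weight N y"
proof -
  have "hamming_weight N (\<lambda>j. x j - y j)
      \<le> card ({j \<in> {1..N}. x j \<noteq> 0} \<union> {j \<in> {1..N}. y j \<noteq> 0})"
    unfolding hamming_weight_def by (intro card_mono) auto
  also have "\<dots> \<le> hamming_weight N x + hamming_weight N y"
    unfolding hamming_weight_def by (rule card_Un_le)
  finally show ?thesis .
qed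

lemma subvec_eqD:
  assumes "subvec x B = subvec y B" "finite B" "k \<in> B"
  shows "x k = y k"
proof -
  obtain j where j: "j < card B" "sorted_list_of_set B ! j = k"
    using assms by (metis in_set_conv_nth length_sorted_list_of_set set_sorted_list_of_set)
  \<comment> \<open>Coordinates start at 1 and list positions at 0, so position \<open>j\<close> of
    the list is coordinate \<open>Suc j\<close>.\<close>
  have "subvec x B (Suc j) = subvec y B (Suc j)"
    using assms by simp
  with j show ?thesis
    by (simp add: subvec_def)
qed

text \<open>The balls of radius \<delta> around the encodings of two messages that receiver
  \<open>i\<close> must tell apart are disjoint, so the received word and the side information
  determine the requested symbol.\<close>

lemma is_ecicI:
  fixes E :: "(nat \<Rightarrow> 'a::field) \<Rightarrow> (nat \<Rightarrow> 'a)"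
  assumes inst: "icsi_instance m n X f"
    and E: "E \<in> vecs n \<rightarrow> vecs N"
    and dist: "\<And>i x y. \<lbrakk>i \<in> {1..m}; x \<in> vecs n; y \<in> vecs n; \<And>k. k \<in> X i \<Longrightarrow> x k = y k; x (f i) \<noteq> y (f i)\<rbrakk>
      \<Longrightarrow> hamming_weight N (\<lambda>j. E x j - E y j) > 2 * \<delta>"
  shows "is_ecic \<delta> (side_info_hypergraph m n X f) N E"
proof -
  have "\<exists>D. \<forall>x\<in>vecs n. \<forall>\<epsilon>\<in>vecs N. hamming_weight N \<epsilon> \<le> \<delta> \<longrightarrow>
      D (vec_add N (E x) \<epsilon>, subvec x (X i)) = x (f i)" if i: "i \<in> {1..m}" for i
  proof -
    have fin: "finite (X i)"
      using inst i unfolding icsi_instance_def by (meson finite_atLeastAtMost finite_subset)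
    have uniq: "x (f i) = y (f i)"
      if xy: "x \<in> vecs n" "y \<in> vecs n" "hamming_weight N d \<le> \<delta>" "hamming_weight N e \<le> \<delta>"
        and rec: "vec_add N (E x) d = vec_add N (E y) e" and sub: "subvec x (X i) = subvec y (X i)"
      for x y d e
    proof (rule ccontr)
      assume "x (f i) \<noteq> y (f i)"
      then have "2 * \<delta> < hamming_weight N (\<lambda>j. E x j - E y j)"
        using dist i xy subvec_eqD [OF sub fin] by blast
      \<comment> \<open>Equal received words turn the difference of the two encodings into a
        difference of two errors, each of weight at most \<delta>.\<close>
      also have "E x j - E y j = e j - d j" if "j \<in> {1..N}" for j
        using fun_cong [OF rec, of j] that by (simp add: vec_add_def algebra_simps)
      then have "hamming_weight N (\<lambda>j. E x j - E y j) = hamming_weight N (\<lambda>j. e j - d j)"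
        unfolding hamming_weight_def by (metis (no_types, lifting))
      also have "\<dots> \<le> 2 * \<delta>"
        using hamming_weight_diff_le [of N e d] xy by linarith
      finally show False by simp
    qed
    \<comment> \<open>The decoder picks some value consistent with its input. By \<open>uniq\<close>
      there is exactly one if the input can arise; on all other inputs the result is
      arbitrary.\<close>
    define D where "D = (\<lambda>(w, s). SOME c. \<exists>x\<in>vecs n. \<exists>\<epsilon>. hamming_weight N \<epsilon> \<le> \<delta> \<and>
      w = vec_add N (E x) \<epsilon> \<and> s = subvec x (X i) \<and> c = x (f i))"
    have "D (vec_add N (E x) \<epsilon>, subvec x (X i)) = x (f i)"
      if "x \<in> vecs n" "hamming_weight N \<epsilon> \<le> \<delta>" for x \<epsilon>
      unfolding D_def prod.case
    proof (rule some_equality)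
      show "\<exists>y\<in>vecs n. \<exists>e. hamming_weight N e \<le> \<delta> \<and>
          vec_add N (E x) \<epsilon> = vec_add N (E y) e \<and> subvec x (X i) = subvec y (X i) \<and> x (f i) = y (f i)"
        using that by blast
    next
      fix c
      assume "\<exists>y\<in>vecs n. \<exists>e. hamming_weight N e \<le> \<delta> \<and>
          vec_add N (E x) \<epsilon> = vec_add N (E y) e \<and> subvec x (X i) = subvec y (X i) \<and> c = y (f i)"
      then obtain y e where "y \<in> vecs n" "hamming_weight N e \<le> \<delta>"
        "vec_add N (E x) \<epsilon> = vec_add N (E y) e" "subvec x (X i) = subvec y (X i)" "c = y (f i)"
        by blast
      then show "c = x (f i)"
        using uniq [of x y \<epsilon> e] that by simp
    qed
    then show ?thesis by blast
  qed
  then show ?thesis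
    using E by (simp add: is_ecic_def side_info_hypergraph_def)
qed

section \<open>Matrices as linear encoders, and the counting of bad ones\<close>

definition vec_mat :: "nat \<Rightarrow> nat \<Rightarrow> (nat \<Rightarrow> 'a::comm_ring_1) \<Rightarrow> (nat \<Rightarrow> nat \<Rightarrow> 'a) \<Rightarrow> (nat \<Rightarrow> 'a)" where
  "vec_mat n N x M = (\<lambda>j\<in>{1..N}. \<Sum>k=1..n. x k * M k j)"

lemma vec_mat_in_vecs: "vec_mat n N x M \<in> vecs N"
  by (simp add: vec_mat_def vecs_def)

text \<open>
  Given \<open>z M\<close> and all rows of \<open>M\<close> but one at which \<open>z\<close> is 1, the missing row can be recovered.
\<close>

lemma card_vec_mat_vimage_le:
  fixes z :: "nat \<Rightarrow> 'a::{comm_ring_1,finite}"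
  assumes p: "p \<in> {1..n}" "z p = 1" and B: "finite B"
  shows "card {M \<in> {1..n} \<rightarrow>\<^sub>E vecs N. vec_mat n N z M \<in> B} \<le> card B * (CARD('a) ^ N) ^ (n - 1)"
proof -
  let ?S = "{M \<in> {1..n} \<rightarrow>\<^sub>E vecs N. vec_mat n N z M \<in> B}"
  let ?T = "B \<times> (({1..n} - {p}) \<rightarrow>\<^sub>E (vecs N :: (nat \<Rightarrow> 'a) set))"
  let ?g = "\<lambda>M. (vec_mat n N z M, restrict M ({1..n} - {p}))"
  have split: "vec_mat n N z M j = M p j + (\<Sum>k\<in>{1..n} - {p}. z k * M k j)"
    if "j \<in> {1..N}" for M j
    using that p by (simp add: vec_mat_def sum.remove [of _ p])
  have "inj_on ?g ?S"
  proof (rule inj_onI)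
    fix M M' assume M: "M \<in> ?S" "M' \<in> ?S" and eq: "?g M = ?g M'"
    have other: "M k = M' k" if "k \<in> {1..n} - {p}" for k
      using eq that by (metis prod.inject restrict_apply')
    have "M p j = M' p j" if "j \<in> {1..N}" for j
    proof -
      have "vec_mat n N z M j = vec_mat n N z M' j"
        using eq by simp
      moreover have "(\<Sum>k\<in>{1..n} - {p}. z k * M k j) = (\<Sum>k\<in>{1..n} - {p}. z k * M' k j)"
        using other by (intro sum.cong) auto
      ultimately show ?thesis
        using that by (simp only: split) simp
    qed
    \<comment> \<open>Rows are extensional, so agreement on \<open>{1..N}\<close> makes them equal
      as functions.\<close>
    moreover have "M p \<in> vecs N" "M' p \<in> vecs N"
      using M p by auto
    ultimately have "M p = M' p"
      unfolding vecs_def by (metis PiE_ext)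
    with other have "M k = M' k" if "k \<in> {1..n}" for k
      using that by (cases "k = p") auto
    then show "M = M'"
      using M by (intro PiE_ext [of M "{1..n}" "\<lambda>_. vecs N" M']) simp_all
  qed
  moreover have "?g ` ?S \<subseteq> ?T"
    by (auto simp: PiE_iff split: if_splits)
  moreover have "finite ?T"
    using B finite_vecs by (intro finite_cartesian_product finite_PiE) auto
  ultimately have "card ?S \<le> card ?T"
    by (rule card_inj_on_le)
  also have "\<dots> = card B * (CARD('a) ^ N) ^ (n - 1)"
    using p by (simp add: card_cartesian_product card_PiE card_vecs)
  finally show ?thesis .
qed

text \<open>The coordinates in \<open>A\<close> and the coordinate \<open>p\<close> are prescribed,
  all others are free; as \<open>p\<close> lies outside \<open>A\<close>, exactly
  \<open>n - card A - 1\<close> are free.\<close>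

lemma card_normalized_confusable:
  assumes "A \<subseteq> {1..n}" "p \<in> {1..n}" "p \<notin> A"
  shows "card {z \<in> vecs n. (\<forall>k\<in>A. z k = 0) \<and> z p = (1::'a::{zero_neq_one,finite})}
    = CARD('a) ^ (n - card A - 1)"
proof -
  let ?P = "\<lambda>k. if k \<in> A then {0::'a} else if k = p then {1} else UNIV"
  have fin: "finite A"
    using assms finite_subset by blast
  have "{z \<in> vecs n. (\<forall>k\<in>A. z k = 0) \<and> z p = (1::'a)} = PiE {1..n} ?P"
    using assms by (auto simp: vecs_def PiE_iff extensional_def split: if_splits)
  moreover have "card (PiE {1..n} ?P) = (\<Prod>k\<in>{1..n}. if k \<in> {1..n} - insert p A then CARD('a) else 1)"
    unfolding card_PiE [OF finite_atLeastAtMost] by (intro prod.cong) auto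
  moreover have "\<dots> = (\<Prod>k\<in>{1..n} \<inter> ({1..n} - insert p A). CARD('a))"
    by (rule prod.inter_restrict [symmetric]) simp
  moreover have "card ({1..n} \<inter> ({1..n} - insert p A)) = n - card A - 1"
    using assms fin by (simp add: Int_absorb1 card_Diff_subset)
  ultimately show ?thesis
    by simp
qed

text \<open>A union bound over all receivers and their normalized vectors, with numbers of matrices
  in place of proportions.\<close>

lemma exists_good_matrix:
  assumes inst: "icsi_instance m n X f"
    and less: "(\<Sum>i=1..m. CARD('a) ^ (n - card (X i) - 1)) * hamming_ball_volume CARD('a) N r
      < CARD('a) ^ N"
  obtains M :: "nat \<Rightarrow> nat \<Rightarrow> 'a::{field,finite}"
  where "\<And>i z. \<lbrakk>i \<in> {1..m}; z \<in> vecs n; \<forall>k\<in>X i. z k = 0; z (f i) = 1\<rbrakk>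
    \<Longrightarrow> hamming_weight N (vec_mat n N z M) > r"
proof -
  define Z where "Z i = {z \<in> vecs n. (\<forall>k\<in>X i. z k = 0) \<and> z (f i) = (1::'a)}" for i
  define B where "B = {y \<in> vecs N. hamming_weight N (y :: nat \<Rightarrow> 'a) \<le> r}"
  define Ms where "Ms = ({1..n} \<rightarrow>\<^sub>E vecs N :: (nat \<Rightarrow> nat \<Rightarrow> 'a) set)"
  define bad where "bad z = {M \<in> Ms. vec_mat n N z M \<in> B}" for z
  \<comment> \<open>The number of choices for all rows but one. It bounds how many matrices send a
    fixed normalized \<open>z\<close> to a given vector.\<close>
  let ?K = "(CARD('a) ^ N) ^ (n - 1)"
  have i_props: "X i \<subseteq> {1..n}" "f i \<in> {1..n}" "f i \<notin> X i" if "i \<in> {1..m}" for i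
    using inst that by (auto simp: icsi_instance_def)
  have finB: "finite B" and finZ: "finite (Z i)" for i
    by (auto simp: B_def Z_def intro: finite_subset [OF _ finite_vecs])
  have finM: "finite Ms"
    unfolding Ms_def using finite_vecs by (intro finite_PiE) auto
  have "card (\<Union>i\<in>{1..m}. \<Union>z\<in>Z i. bad z) \<le> (\<Sum>i=1..m. card (\<Union>z\<in>Z i. bad z))"
    by (rule card_UN_le) simp
  also have "\<dots> \<le> (\<Sum>i=1..m. \<Sum>z\<in>Z i. card (bad z))"
    by (intro sum_mono card_UN_le finZ)
  also have "\<dots> \<le> (\<Sum>i=1..m. \<Sum>z\<in>Z i. card B * ?K)"
  proof (intro sum_mono)
    fix i z assume "i \<in> {1..m}" "z \<in> Z i"
    then show "card (bad z) \<le> card B * ?K"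
      unfolding bad_def Ms_def using i_props
      by (intro card_vec_mat_vimage_le [where p = "f i"] finB) (auto simp: Z_def)
  qed
  also have "\<dots> = (\<Sum>i=1..m. CARD('a) ^ (n - card (X i) - 1)) * hamming_ball_volume CARD('a) N r * ?K"
  proof -
    have "card (Z i) = CARD('a) ^ (n - card (X i) - 1)" if "i \<in> {1..m}" for i
      unfolding Z_def using i_props [OF that] by (rule card_normalized_confusable)
    then show ?thesis
      by (simp add: B_def card_hamming_ball sum_distrib_right mult.assoc)
  qed
  also have "\<dots> < CARD('a) ^ N * ?K"
    using less by (intro mult_strict_right_mono) auto
  also have "\<dots> = card Ms"
  proof -
    \<comment> \<open>Subtraction is truncated, so this is what gives \<open>Suc (n - 1) = n\<close>
      and hence the full count of matrices.\<close>
    have "1 \<le> n"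
      using inst by (simp add: icsi_instance_def)
    then show ?thesis
      by (simp add: Ms_def card_PiE card_vecs flip: power_Suc)
  qed
  finally have "\<not> Ms \<subseteq> (\<Union>i\<in>{1..m}. \<Union>z\<in>Z i. bad z)"
    using card_mono [of "\<Union>i\<in>{1..m}. \<Union>z\<in>Z i. bad z" Ms] finM finZ
    by (auto simp: bad_def)
  then obtain M where "M \<in> Ms" "\<And>i z. i \<in> {1..m} \<Longrightarrow> z \<in> Z i \<Longrightarrow> M \<notin> bad z"
    by blast
  then show ?thesis
    by (intro that [of M]) (auto simp: bad_def B_def Z_def vec_mat_in_vecs not_le)
qed

theorem mainTheorem5:
  fixes m n N \<delta> q :: nat
    and X :: "nat \<Rightarrow> nat set"
    and f :: "nat \<Rightarrow> nat"
  assumes "q = CARD('a::{field,finite})"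
    and "icsi_instance m n X f"
    and "(\<Sum>i=1..m. real q ^ (n - card (X i) - 1))
           < real q ^ N / real (hamming_ball_volume q N (2 * \<delta>))"
  shows "\<exists>E :: (nat \<Rightarrow> 'a) \<Rightarrow> (nat \<Rightarrow> 'a). is_ecic \<delta> (side_info_hypergraph m n X f) N E"
proof -
  let ?V = "hamming_ball_volume q N (2 * \<delta>)"
  \<comment> \<open>Division by zero yields 0, so a vanishing \<open>?V\<close> would put a sum of
    nonnegative terms strictly below 0.\<close>
  have "?V > 0"
  proof (rule ccontr)
    assume "\<not> ?V > 0"
    with assms(3) have "(\<Sum>i=1..m. real q ^ (n - card (X i) - 1)) < 0"
      by simp
    moreover have "(\<Sum>i=1..m. real q ^ (n - card (X i) - 1)) \<ge> 0"
      by (intro sum_nonneg) simp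
    ultimately show False by simp
  qed
  then have "real ((\<Sum>i=1..m. q ^ (n - card (X i) - 1)) * ?V) < real (q ^ N)"
    using assms(3) by (simp add: pos_less_divide_eq)
  then have "(\<Sum>i=1..m. CARD('a) ^ (n - card (X i) - 1)) * hamming_ball_volume CARD('a) N (2 * \<delta>)
      < CARD('a) ^ N"
    unfolding of_nat_less_iff assms(1) .
  from exists_good_matrix [OF assms(2) this] obtain M :: "nat \<Rightarrow> nat \<Rightarrow> 'a"
    where M: "\<And>i z. \<lbrakk>i \<in> {1..m}; z \<in> vecs n; \<forall>k\<in>X i. z k = 0; z (f i) = 1\<rbrakk>
      \<Longrightarrow> hamming_weight N (vec_mat n N z M) > 2 * \<delta>"
    by metis
  have "is_ecic \<delta> (side_info_hypergraph m n X f) N (\<lambda>x. vec_mat n N x M)"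
  proof (rule is_ecicI [OF assms(2)])
    show "(\<lambda>x. vec_mat n N x M) \<in> vecs n \<rightarrow> vecs N"
      by (simp add: vec_mat_in_vecs)
  next
    fix i and x y :: "nat \<Rightarrow> 'a"
    assume i: "i \<in> {1..m}" and xy: "\<And>k. k \<in> X i \<Longrightarrow> x k = y k" "x (f i) \<noteq> y (f i)"
    \<comment> \<open>Scaling by \<open>c\<close> makes the difference of the two messages equal to
      1 at \<open>f i\<close>, as the choice of \<open>M\<close> requires.\<close>
    define c where "c = inverse (x (f i) - y (f i))"
    define z where "z = (\<lambda>k\<in>{1..n}. c * (x k - y k))"
    have c: "c \<noteq> 0" "c * (x (f i) - y (f i)) = 1"
      using xy by (simp_all add: c_def)
    have "X i \<subseteq> {1..n}" "f i \<in> {1..n}"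
      using assms(2) i by (auto simp: icsi_instance_def)
    then have "hamming_weight N (vec_mat n N z M) > 2 * \<delta>"
      using i xy c by (intro M [of i]) (auto simp: z_def vecs_def)
    \<comment> \<open>By linearity \<open>z\<close> is mapped to \<open>c\<close> times the
      difference of the encodings, and a nonzero factor preserves the support.\<close>
    moreover have "vec_mat n N z M j = c * (vec_mat n N x M j - vec_mat n N y M j)" if "j \<in> {1..N}" for j
      using that by (simp add: vec_mat_def z_def sum_distrib_left sum_subtractf [symmetric] algebra_simps)
    then have "hamming_weight N (vec_mat n N z M)
        = hamming_weight N (\<lambda>j. vec_mat n N x M j - vec_mat n N y M j)"
      unfolding hamming_weight_def using c(1)
      by (intro arg_cong [of _ _ card] Collect_cong) auto
    ultimately show "hamming_weight N (\<lambda>j. vec_mat n N x M j - vec_mat n N y M j) > 2 * \<delta>"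
      by simp
  qed
  then show ?thesis by blast
qed

end
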